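(* A Type 2 NG-graph $G$ is an NGD-graph if and only if $D(G)=|A_G|$ or $D(G)$ equals the number of vertices in $B_G$ that have no adjacencies to vertices in $C_G$.
   Context: Graphs are finite and simple. $\overline{G}$ is the complement of $G$, $\chi$ the chromatic number, and $G[S]$ the subgraph induced by $S$. A coloring of $V(G)$ is distinguishing if the only automorphism of $G$ preserving all vertex colors is the identity; $D(G)$ is the minimum number of colors in a distinguishing coloring of $G$, and $\chi_D(G)$ is the minimum number of colors in a coloring of $G$ that is both proper and distinguishing. With $n=|V(G)|$, $G$ is an NG-graph if $\chi(G)+\chi(\overline{G})=n+1$, and an NGD-graph if $\chi_D(G)+\chi_D(\overline{G})=n+D(G)$. For an NG-graph $G$, $A_G=\{v:\deg(v)=\chi(G)-1\}$, $B_G=\{v:\deg(v)>\chi(G)-1\}$, $C_G=\{v:\deg(v)<\chi(G)-1\}$; $G$ is of Type 2 if $G[A_G]$ is an independent set. *)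

theory Defs
  imports "Graph_Theory.Graph_Theory"
begin

text \<open>
  A finite simple graph is a \<^locale>\<open>pair_graph\<close>: every edge \<open>uv\<close> is represented by the two
  arcs \<open>(u, v)\<close> and \<open>(v, u)\<close>, so the degree of a vertex is its \<^const>\<open>out_degree\<close>.
\<close>

definition complement :: "'a pair_pre_digraph \<Rightarrow> 'a pair_pre_digraph" where
  "complement G = \<lparr> pverts = pverts G,
     parcs = {(u, v). u \<in> pverts G \<and> v \<in> pverts G \<and> u \<noteq> v \<and> (u, v) \<notin> parcs G} \<rparr>"

lemma pair_graph_complement:
  assumes "pair_graph G"
  shows "pair_graph (complement G)"
proof -
  interpret pair_graph G by fact
  have "finite (parcs (complement G))"
    by (rule finite_subset[of _ "pverts G \<times> pverts G"])
      (auto simp: complement_def pair_finite_verts)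
  moreover have "symmetric (with_proj (complement G))"
    using arcs_ends_symmetric[OF pair_sym_arcs]
    by (auto simp: symmetric_def complement_def sym_def)
  ultimately show ?thesis
    by unfold_locales (auto simp: complement_def pair_finite_verts)
qed


text \<open>
  A colouring is a function to \<^typ>\<open>nat\<close> and only its values on the vertices matter; the number
  of colours is the number of values taken there.
\<close>

definition num_colors :: "'a pair_pre_digraph \<Rightarrow> ('a \<Rightarrow> nat) \<Rightarrow> nat" where
  "num_colors G c = card (c ` pverts G)"

definition proper_coloring :: "'a pair_pre_digraph \<Rightarrow> ('a \<Rightarrow> nat) \<Rightarrow> bool" where
  "proper_coloring G c \<longleftrightarrow> (\<forall>(u, v) \<in> parcs G. c u \<noteq> c v)"

definition automorphism :: "'a pair_pre_digraph \<Rightarrow> ('a \<Rightarrow> 'a) \<Rightarrow> bool" where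
  "automorphism G f \<longleftrightarrow> bij_betw f (pverts G) (pverts G) \<and>
     (\<forall>u \<in> pverts G. \<forall>v \<in> pverts G. (f u, f v) \<in> parcs G \<longleftrightarrow> (u, v) \<in> parcs G)"

definition distinguishing_coloring :: "'a pair_pre_digraph \<Rightarrow> ('a \<Rightarrow> nat) \<Rightarrow> bool" where
  "distinguishing_coloring G c \<longleftrightarrow>
     (\<forall>f. automorphism G f \<longrightarrow> (\<forall>v \<in> pverts G. c (f v) = c v) \<longrightarrow> (\<forall>v \<in> pverts G. f v = v))"

definition chromatic_number :: "'a pair_pre_digraph \<Rightarrow> nat" where
  "chromatic_number G = (LEAST k. \<exists>c. proper_coloring G c \<and> num_colors G c = k)"

definition distinguishing_number :: "'a pair_pre_digraph \<Rightarrow> nat" where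
  "distinguishing_number G = (LEAST k. \<exists>c. distinguishing_coloring G c \<and> num_colors G c = k)"

definition distinguishing_chromatic_number :: "'a pair_pre_digraph \<Rightarrow> nat" where
  "distinguishing_chromatic_number G =
     (LEAST k. \<exists>c. proper_coloring G c \<and> distinguishing_coloring G c \<and> num_colors G c = k)"


definition NG_graph :: "'a pair_pre_digraph \<Rightarrow> bool" where
  "NG_graph G \<longleftrightarrow>
     chromatic_number G + chromatic_number (complement G) = card (pverts G) + 1"

definition NGD_graph :: "'a pair_pre_digraph \<Rightarrow> bool" where
  "NGD_graph G \<longleftrightarrow>
     distinguishing_chromatic_number G + distinguishing_chromatic_number (complement G)
       = card (pverts G) + distinguishing_number G"

text \<open>
  The subtractions below do not truncate: a graph with a vertex has chromatic number at least 1.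
\<close>

definition A_part :: "'a pair_pre_digraph \<Rightarrow> 'a set" where
  "A_part G = {v \<in> pverts G. out_degree G v = chromatic_number G - 1}"

definition B_part :: "'a pair_pre_digraph \<Rightarrow> 'a set" where
  "B_part G = {v \<in> pverts G. out_degree G v > chromatic_number G - 1}"

definition C_part :: "'a pair_pre_digraph \<Rightarrow> 'a set" where
  "C_part G = {v \<in> pverts G. out_degree G v < chromatic_number G - 1}"

definition type2 :: "'a pair_pre_digraph \<Rightarrow> bool" where
  "type2 G \<longleftrightarrow> arcs (with_proj G \<restriction> A_part G) = {}"

end

theory Submission
  imports Defs
begin

text \<open>
  Write \<open>A\<close>, \<open>B\<close>, \<open>C\<close> for the three degree classes of a Type 2 NG-graph \<open>G\<close> and \<open>p\<close> for its
  chromatic number. Vertices of degree less than \<open>k\<close> never obstruct a greedy colouring with \<open>k\<close>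
  colours. So \<open>A \<union> B\<close> cannot be coloured with \<open>p - 1\<close> colours in \<open>G\<close>, nor \<open>A \<union> C\<close> with one
  colour less than the chromatic number of the complement in that complement. Since the two
  chromatic numbers add up to \<open>n + 1\<close> and the independent set \<open>A\<close> needs one colour, there is no slack:
  \<open>A\<close> is nonempty, \<open>B\<close> is a clique with \<open>p - 1\<close> vertices, \<open>A \<union> C\<close> is independent, and the
  neighbourhood of every vertex of \<open>A\<close> is \<open>B\<close> (lemma \<open>type2_NG_structure\<close>).

  Hence \<open>G\<close> is a split graph whose clique \<open>B\<close> is preserved by automorphisms, because these preserve
  degrees; the complement is such a graph too, with clique \<open>A \<union> C\<close>. In a split graph of this kind
  a proper colouring is distinguishing exactly when independent vertices with the same
  neighbourhood (twins) get distinct colours, so its distinguishing chromatic number is the larger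
  of the size of the clique and the largest value of (number of twins of \<open>v\<close>) + (degree of \<open>v\<close>)
  over the independent vertices \<open>v\<close> (lemma \<open>distinguishing_chromatic_number_le_iff\<close>).
  The number \<open>D = D(G) = D(complement G)\<close> enters through one inequality: it is at least the size of
  every class of twins, since exchanging two twins is an automorphism.

  For \<open>y \<in> C\<close> and \<open>x \<in> B\<close> let \<open>t y\<close> and \<open>t' x\<close> count the twins, and let \<open>d y\<close> and \<open>d' x\<close> be the
  degrees in \<open>G\<close> and in the complement; then \<open>d y < |B|\<close> and \<open>d' x \<le> |C|\<close>. The formula gives
  \<open>P = max (|A| + |B|) (max_y (t y + d y))\<close> and \<open>Q = max (|A| + |C|) (max_x (t' x + d' x))\<close> for the
  distinguishing chromatic numbers of \<open>G\<close> and of its complement. The class \<open>B0\<close> of the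
  vertices of \<open>B\<close> without neighbours in \<open>C\<close> is, unless empty, the twin class with \<open>d' x = |C|\<close>.

  If \<open>D = |A|\<close>, no twin class is larger than \<open>A\<close>, so \<open>P = |A| + |B|\<close> and \<open>Q = |A| + |C|\<close>, with sum
  \<open>n + D\<close>. If \<open>D = |B0|\<close>, then \<open>t y + d y \<le> |B0| + (|B| - |B0|)\<close> for \<open>y \<in> C\<close>, whose neighbours lie
  outside \<open>B0\<close>; so \<open>P = |A| + |B|\<close> again, and \<open>Q = |B0| + |C|\<close>.

  Conversely let \<open>P + Q = n + D\<close>. The value of \<open>P\<close> cannot come from a \<open>y \<in> C\<close> beyond \<open>|A| + |B|\<close>: in combination with \<open>|A| + |C|\<close> this fails as
  \<open>t y + d y < D + |B|\<close>, and in combination with an \<open>x \<in> B\<close> it fails because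
  \<open>t y + d' x \<le> |C|\<close> if \<open>x\<close> and \<open>y\<close> are adjacent and \<open>t' x + d y \<le> |B|\<close> otherwise. So
  \<open>P = |A| + |B|\<close>, and then either \<open>Q = |A| + |C|\<close> and \<open>D = |A|\<close>, or
  \<open>D + |C| = t' x + d' x\<close> for some \<open>x \<in> B\<close>, which forces \<open>d' x = |C|\<close>, \<open>x \<in> B0\<close> and \<open>D = |B0|\<close>.
\<close>

section \<open>Neighbourhoods and complements\<close>

definition neighbors :: "'a pair_pre_digraph \<Rightarrow> 'a \<Rightarrow> 'a set" where
  "neighbors G v = {u. (v, u) \<in> parcs G}"

lemma in_neighbors_iff [simp]: "u \<in> neighbors G v \<longleftrightarrow> (v, u) \<in> parcs G"
  by (simp add: neighbors_def)

lemma adjacent_sym: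
  assumes "pair_graph G" "(u, v) \<in> parcs G"
  shows "(v, u) \<in> parcs G"
proof -
  interpret pair_graph G by fact
  show ?thesis using arcs_ends_symmetric[OF pair_sym_arcs] assms(2) by (auto simp: sym_def)
qed

lemma adjacent_irrefl:
  assumes "pair_graph G"
  shows "(v, v) \<notin> parcs G"
proof -
  interpret pair_graph G by fact
  show ?thesis using pair_no_loops[of "(v, v)"] by auto
qed

lemma adjacent_in_pverts:
  assumes "pair_graph G" "(u, v) \<in> parcs G"
  shows "u \<in> pverts G" "v \<in> pverts G"
proof -
  interpret pair_graph G by fact
  show "u \<in> pverts G" "v \<in> pverts G" using in_arcsD1 in_arcsD2 assms(2) by blast+
qed

lemma finite_pverts:
  assumes "pair_graph G"
  shows "finite (pverts G)"
proof -
  interpret pair_graph G by fact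
  show ?thesis by (rule pair_finite_verts)
qed

lemma neighbors_subset_pverts: "pair_graph G \<Longrightarrow> neighbors G v \<subseteq> pverts G"
  using adjacent_in_pverts(2)[of G v] by auto

lemma finite_neighbors: "pair_graph G \<Longrightarrow> finite (neighbors G v)"
  by (rule finite_subset[OF neighbors_subset_pverts finite_pverts])

lemma out_degree_eq_card_neighbors: "out_degree (with_proj G) v = card (neighbors G v)"
proof -
  have "out_arcs (with_proj G) v = Pair v ` neighbors G v"
    by (auto simp: out_arcs_def)
  then show ?thesis
    by (simp add: out_degree_def card_image inj_on_def)
qed

lemma pverts_complement [simp]: "pverts (complement G) = pverts G"
  by (simp add: complement_def)

lemma in_parcs_complement [simp]:
  "(u, v) \<in> parcs (complement G) \<longleftrightarrow>
     u \<in> pverts G \<and> v \<in> pverts G \<and> u \<noteq> v \<and> (u, v) \<notin> parcs G"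
  by (simp add: complement_def)

lemma neighbors_complement:
  "v \<in> pverts G \<Longrightarrow> neighbors (complement G) v = pverts G - insert v (neighbors G v)"
  by auto

lemma card_neighbors_complement:
  assumes "pair_graph G" "v \<in> pverts G"
  shows "card (neighbors (complement G) v) = card (pverts G) - Suc (card (neighbors G v))"
  using assms finite_pverts[OF assms(1)] finite_neighbors[OF assms(1)]
    neighbors_subset_pverts[OF assms(1), of v] adjacent_irrefl[OF assms(1), of v]
  by (simp add: neighbors_complement card_Diff_subset)

section \<open>Colourings and automorphisms\<close>

lemma card_le_num_colors:
  assumes "finite (pverts G)" "inj_on c S" "S \<subseteq> pverts G"
  shows "card S \<le> num_colors G c"
proof -
  have "card S = card (c ` S)" using assms(2) by (simp add: card_image)
  also have "\<dots> \<le> card (c ` pverts G)" using assms by (intro card_mono) auto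
  finally show ?thesis by (simp add: num_colors_def)
qed

lemma chromatic_number_le:
  "proper_coloring G c \<Longrightarrow> chromatic_number G \<le> num_colors G c"
  unfolding chromatic_number_def by (rule Least_le) blast

text \<open>
  Supplies the existence of colourings of all kinds, without which the minima that define the
  chromatic parameters would say nothing.
\<close>

lemma injective_coloring:
  assumes "pair_graph G"
  obtains c :: "'a \<Rightarrow> nat" where "inj_on c (pverts G)"
    "proper_coloring (G :: 'a pair_pre_digraph) c" "distinguishing_coloring G c"
proof -
  obtain c :: "'a \<Rightarrow> nat" where inj: "inj_on c (pverts G)"
    using finite_imp_inj_to_nat_seg[OF finite_pverts[OF assms]] by blast
  moreover have "proper_coloring G c"
    unfolding proper_coloring_def
  proof clarify
    fix u v assume uv: "(u, v) \<in> parcs G" "c u = c v"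
    then have "u = v" using inj adjacent_in_pverts[OF assms uv(1)] by (auto dest: inj_onD)
    then show False using uv(1) adjacent_irrefl[OF assms] by simp
  qed
  moreover have "distinguishing_coloring G c"
    unfolding distinguishing_coloring_def automorphism_def
    using inj by (metis bij_betwE inj_onD)
  ultimately show thesis by (rule that)
qed

lemma chromatic_number_le_card_pverts:
  assumes "pair_graph G"
  shows "chromatic_number G \<le> card (pverts G)"
proof -
  obtain c where "inj_on c (pverts G)" "proper_coloring G c"
    using injective_coloring[OF assms] .
  then show ?thesis using chromatic_number_le[of G c] by (simp add: num_colors_def card_image)
qed

lemma distinguishing_number_attained:
  assumes "pair_graph G"
  obtains c where "distinguishing_coloring G c" "num_colors G c = distinguishing_number G"
proof -
  obtain c where "distinguishing_coloring G c" using injective_coloring[OF assms] .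
  then have "\<exists>k. \<exists>c. distinguishing_coloring G c \<and> num_colors G c = k" by blast
  from LeastI_ex[OF this] show thesis
    unfolding distinguishing_number_def[symmetric] by (elim exE conjE) (rule that)
qed

lemma distinguishing_chromatic_number_attained:
  assumes "pair_graph G"
  obtains c where "proper_coloring G c" "distinguishing_coloring G c"
    "num_colors G c = distinguishing_chromatic_number G"
proof -
  obtain c where "proper_coloring G c" "distinguishing_coloring G c"
    using injective_coloring[OF assms] .
  then have "\<exists>k. \<exists>c. proper_coloring G c \<and> distinguishing_coloring G c \<and> num_colors G c = k"
    by blast
  from LeastI_ex[OF this] show thesis
    unfolding distinguishing_chromatic_number_def[symmetric] by (elim exE conjE) (rule that)
qed

lemma distinguishing_chromatic_number_le:
  "\<lbrakk>proper_coloring G c; distinguishing_coloring G c\<rbrakk>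
    \<Longrightarrow> distinguishing_chromatic_number G \<le> num_colors G c"
  unfolding distinguishing_chromatic_number_def by (rule Least_le) blast

text \<open>
  An injective map preserves adjacency of distinct vertices exactly when it preserves
  non-adjacency of distinct vertices.
\<close>

lemma automorphism_complement_iff:
  assumes "pair_graph G"
  shows "automorphism (complement G) f \<longleftrightarrow> automorphism G f"
proof (cases "bij_betw f (pverts G) (pverts G)")
  case True
  have "((f u, f v) \<in> parcs (complement G) \<longleftrightarrow> (u, v) \<in> parcs (complement G)) \<longleftrightarrow>
      ((f u, f v) \<in> parcs G \<longleftrightarrow> (u, v) \<in> parcs G)" if "u \<in> pverts G" "v \<in> pverts G" for u v
  proof -
    have "f u \<in> pverts G" "f v \<in> pverts G" "f u = f v \<longleftrightarrow> u = v"
      using True that by (auto simp: bij_betw_def inj_on_def)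
    then show ?thesis
      using that adjacent_irrefl[OF assms, of u] adjacent_irrefl[OF assms, of "f u"] by auto
  qed
  then show ?thesis by (simp add: automorphism_def)
qed (simp add: automorphism_def)

lemma distinguishing_number_complement:
  "pair_graph G \<Longrightarrow> distinguishing_number (complement G) = distinguishing_number G"
  by (simp add: distinguishing_number_def distinguishing_coloring_def num_colors_def
      automorphism_complement_iff)

text \<open>
  Otherwise the transposition of \<open>u\<close> and \<open>v\<close> would be a nontrivial automorphism that preserves
  colours.
\<close>

lemma twins_get_distinct_colors:
  assumes G: "pair_graph G" and c: "distinguishing_coloring G c"
    and uv: "u \<in> pverts G" "v \<in> pverts G" "u \<noteq> v" and twins: "neighbors G u = neighbors G v"
  shows "c u \<noteq> c v"
proof
  assume same: "c u = c v"
  define f where "f = id(u := v, v := u)"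
  have ff: "f (f x) = x" for x by (simp add: f_def)
  have "f x \<in> pverts G" if "x \<in> pverts G" for x using that uv by (simp add: f_def)
  then have bij: "bij_betw f (pverts G) (pverts G)"
    using ff by (intro bij_betw_byWitness[where f' = f]) auto
  have tw: "(u, x) \<in> parcs G \<longleftrightarrow> (v, x) \<in> parcs G"
    and tw': "(x, u) \<in> parcs G \<longleftrightarrow> (x, v) \<in> parcs G" for x
    using twins adjacent_sym[OF G] by (auto simp: set_eq_iff)
  have "automorphism G f"
    unfolding automorphism_def using bij by (auto simp: f_def tw tw')
  moreover have "\<forall>x \<in> pverts G. c (f x) = c x" using same by (simp add: f_def)
  ultimately have "f u = u" using c uv unfolding distinguishing_coloring_def by blast
  then show False using uv by (simp add: f_def)
qed

lemma automorphism_preserves_degree: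
  assumes G: "pair_graph G" and f: "automorphism G f" and v: "v \<in> pverts G"
  shows "card (neighbors G (f v)) = card (neighbors G v)"
proof -
  have bij: "bij_betw f (pverts G) (pverts G)" using f by (simp add: automorphism_def)
  have "neighbors G (f v) = f ` neighbors G v"
  proof
    show "f ` neighbors G v \<subseteq> neighbors G (f v)"
      using f v adjacent_in_pverts[OF G] unfolding automorphism_def by auto
    show "neighbors G (f v) \<subseteq> f ` neighbors G v"
    proof
      fix w assume w: "w \<in> neighbors G (f v)"
      then have "w \<in> f ` pverts G" using bij adjacent_in_pverts[OF G] by (auto simp: bij_betw_def)
      then obtain x where "x \<in> pverts G" "w = f x" by blast
      then show "w \<in> f ` neighbors G v" using f v w unfolding automorphism_def by auto
    qed
  qed
  moreover have "inj_on f (neighbors G v)"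
    using bij neighbors_subset_pverts[OF G] by (metis bij_betw_def inj_on_subset)
  ultimately show ?thesis by (simp add: card_image)
qed

section \<open>The structure of Type 2 NG-graphs\<close>

text \<open>
  The vertices outside \<open>S\<close> can be coloured one at a time, in any order: each has fewer than \<open>k\<close>
  neighbours, so one of \<open>k\<close> colours is free. The colouring \<open>h\<close> of \<open>S\<close> may take values of any type,
  so that vertices themselves can serve as colours.
\<close>

lemma chromatic_number_le_by_greedy_extension:
  assumes G: "pair_graph G" and "S \<subseteq> pverts G"
    and proper: "\<And>u v. u \<in> S \<Longrightarrow> v \<in> S \<Longrightarrow> (u, v) \<in> parcs G \<Longrightarrow> h u \<noteq> h v"
    and few: "card (h ` S) \<le> k"
    and low: "\<And>v. v \<in> pverts G - S \<Longrightarrow> card (neighbors G v) < k"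
  shows "chromatic_number G \<le> k"
proof -
  have "finite S" by (rule finite_subset[OF assms(2) finite_pverts[OF G]])
  then have "\<exists>r. r ` h ` S \<subseteq> {..<k} \<and> inj_on r (h ` S)"
    using few by (intro card_le_inj) simp_all
  then obtain r where r: "r ` h ` S \<subseteq> {..<k}" "inj_on r (h ` S)" by (elim exE conjE)
  have start: "\<exists>c. (\<forall>u\<in>S. c u < k) \<and> (\<forall>u\<in>S. \<forall>v\<in>S. (u, v) \<in> parcs G \<longrightarrow> c u \<noteq> c v)"
  proof (intro exI[of _ "r \<circ> h"] conjI ballI impI)
    fix u v assume "u \<in> S" "v \<in> S" "(u, v) \<in> parcs G"
    then show "(r \<circ> h) u \<noteq> (r \<circ> h) v" using proper[of u v] inj_onD[OF r(2), of "h u" "h v"] by auto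
  qed (use r(1) in auto)
  have ext: "\<exists>c. (\<forall>u \<in> S \<union> R. c u < k) \<and>
      (\<forall>u \<in> S \<union> R. \<forall>v \<in> S \<union> R. (u, v) \<in> parcs G \<longrightarrow> c u \<noteq> c v)"
    if "finite R" "R \<subseteq> pverts G - S" for R
    using that
  proof (induction R rule: finite_induct)
    case empty
    show ?case using start by simp
  next
    case (insert v R)
    then obtain c where c: "\<forall>u \<in> S \<union> R. c u < k"
      "\<forall>u \<in> S \<union> R. \<forall>w \<in> S \<union> R. (u, w) \<in> parcs G \<longrightarrow> c u \<noteq> c w"
      by auto
    have "card (c ` neighbors G v) < card {..<k}"
      using card_image_le[OF finite_neighbors[OF G, of v], of c] low[of v] insert.prems by auto
    then have "\<not> {..<k} \<subseteq> c ` neighbors G v"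
      using card_mono[OF finite_imageI[OF finite_neighbors[OF G]], of "{..<k}" c v] by linarith
    then obtain i where i: "i < k" "i \<notin> c ` neighbors G v" by auto
    show ?case
    proof (intro exI[of _ "c(v := i)"] conjI ballI impI)
      fix u w assume uw: "u \<in> S \<union> insert v R" "w \<in> S \<union> insert v R" "(u, w) \<in> parcs G"
      have "u \<noteq> w" "(w, u) \<in> parcs G"
        using uw(3) adjacent_irrefl[OF G] adjacent_sym[OF G] by auto
      then show "(c(v := i)) u \<noteq> (c(v := i)) w" using uw i c by (auto simp: image_iff)
    qed (use c i in auto)
  qed
  obtain c where c: "\<forall>u \<in> pverts G. c u < k"
      "\<forall>u \<in> pverts G. \<forall>v \<in> pverts G. (u, v) \<in> parcs G \<longrightarrow> c u \<noteq> c v"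
    using ext[of "pverts G - S"] finite_pverts[OF G] assms(2) by (auto simp: Un_absorb1)
  have "proper_coloring G c"
    using c adjacent_in_pverts[OF G] unfolding proper_coloring_def by auto
  then have "chromatic_number G \<le> card (c ` pverts G)"
    using chromatic_number_le by (auto simp: num_colors_def)
  also have "\<dots> \<le> card {..<k}" using c by (intro card_mono) auto
  finally show ?thesis by simp
qed

text \<open>
  Every part of the structure comes from a colouring that would otherwise be too cheap. Greedy
  extension gives that \<open>A \<union> B\<close> needs \<open>p\<close> colours in \<open>G\<close> and \<open>A \<union> C\<close> needs \<open>q\<close> colours in the
  complement, where \<open>p\<close> and \<open>q\<close> are the chromatic numbers. The second fact bounds \<open>|B|\<close> by
  \<open>n - q = p - 1\<close>, while \<open>B\<close> together with one colour for \<open>A\<close> has to provide \<open>p\<close> colours; all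
  bounds are thus tight, and two vertices that could share a colour give a contradiction. Finally,
  the neighbours of \<open>a \<in> A\<close> all lie in \<open>B\<close>, and there are \<open>p - 1\<close> of them, as many as \<open>B\<close> has.
\<close>

lemma type2_NG_structure:
  assumes G: "pair_graph G" and NG: "NG_graph G" and t2: "type2 G"
  shows "A_part G \<noteq> {}"
    and "\<And>u v. u \<in> B_part G \<Longrightarrow> v \<in> B_part G \<Longrightarrow> u \<noteq> v \<Longrightarrow> (u, v) \<in> parcs G"
    and "\<And>u v. u \<in> A_part G \<union> C_part G \<Longrightarrow> v \<in> A_part G \<union> C_part G \<Longrightarrow> (u, v) \<notin> parcs G"
    and "\<And>a. a \<in> A_part G \<Longrightarrow> neighbors G a = B_part G"
    and "card (B_part G) = chromatic_number G - 1"
proof -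
  let ?A = "A_part G" and ?B = "B_part G" and ?C = "C_part G"
  define p where "p = chromatic_number G"
  define q where "q = chromatic_number (complement G)"
  define n where "n = card (pverts G)"
  note G' = pair_graph_complement[OF G]
  have pq: "p + q = n + 1" using NG by (simp add: NG_graph_def p_def q_def n_def)
  have "p \<le> n" "q \<le> n"
    using chromatic_number_le_card_pverts[OF G] chromatic_number_le_card_pverts[OF G']
    by (simp_all add: p_def q_def n_def)
  with pq have pos: "p \<ge> 1" "q \<ge> 1" by simp_all
  have A: "?A = {v \<in> pverts G. card (neighbors G v) = p - 1}"
    and B: "?B = {v \<in> pverts G. card (neighbors G v) > p - 1}"
    and C: "?C = {v \<in> pverts G. card (neighbors G v) < p - 1}"
    by (simp_all add: A_part_def B_part_def C_part_def p_def out_degree_eq_card_neighbors)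
  have fin: "finite ?A" "finite ?B" "finite ?C" using finite_pverts[OF G] by (auto simp: A B C)
  have "card (?A \<union> ?C) + card ?B = card (?A \<union> ?C \<union> ?B)"
    using fin by (intro card_Un_disjoint[symmetric]) (auto simp: A B C)
  also have "?A \<union> ?C \<union> ?B = pverts G" by (auto simp: A B C)
  finally have cards: "card (?A \<union> ?C) + card ?B = n" by (simp add: n_def)
  have A_indep: "(u, v) \<notin> parcs G" if "u \<in> ?A" "v \<in> ?A" for u v
    using t2 that by (auto simp: type2_def)
  have many: "card (h ` (?A \<union> ?B)) \<ge> p"
    if "\<And>u v. u \<in> ?A \<union> ?B \<Longrightarrow> v \<in> ?A \<union> ?B \<Longrightarrow> (u, v) \<in> parcs G \<Longrightarrow> h u \<noteq> h v"
    for h :: "'a \<Rightarrow> 'a"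
  proof (rule ccontr)
    assume "\<not> p \<le> card (h ` (?A \<union> ?B))"
    then have "chromatic_number G \<le> p - 1"
      using pos that
      by (intro chromatic_number_le_by_greedy_extension[OF G, where S = "?A \<union> ?B" and h = h])
        (auto simp: A B)
    then show False using pos by (simp add: p_def)
  qed
  have many': "card (h ` (?A \<union> ?C)) \<ge> q"
    if "\<And>u v. u \<in> ?A \<union> ?C \<Longrightarrow> v \<in> ?A \<union> ?C \<Longrightarrow> u \<noteq> v \<Longrightarrow> (u, v) \<notin> parcs G \<Longrightarrow> h u \<noteq> h v"
    for h :: "'a \<Rightarrow> 'a"
  proof (rule ccontr)
    assume "\<not> q \<le> card (h ` (?A \<union> ?C))"
    then have "chromatic_number (complement G) \<le> q - 1"
    proof (intro chromatic_number_le_by_greedy_extension[OF G', where S = "?A \<union> ?C" and h = h])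
      fix v assume "v \<in> pverts (complement G) - (?A \<union> ?C)"
      then have v: "v \<in> pverts G" "card (neighbors G v) > p - 1" by (auto simp: A C)
      moreover have "card (neighbors (complement G) v) < card (pverts G)"
        using card_neighbors_complement[OF G v(1)] v(1) finite_pverts[OF G]
        by (metis card_gt_0_iff diff_less emptyE zero_less_Suc)
      moreover have "card (neighbors G v) < card (pverts G)"
        using neighbors_subset_pverts[OF G, of v] finite_pverts[OF G] adjacent_irrefl[OF G, of v] v(1)
        by (metis in_neighbors_iff psubsetI psubset_card_mono)
      ultimately show "card (neighbors (complement G) v) < q - 1"
        using card_neighbors_complement[OF G v(1)] pq pos by (simp add: n_def)
    qed (use that in \<open>auto simp: A C\<close>)
    then show False using pos by (simp add: q_def)
  qed
  have "q \<le> card (?A \<union> ?C)" using many'[of id] by simp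
  then have B_le: "card ?B \<le> p - 1" using cards pq by simp
  show "?A \<noteq> {}"
  proof
    assume "?A = {}"
    then have "p \<le> card ?B" using many[of id] adjacent_irrefl[OF G] by auto
    then show False using B_le pos by simp
  qed
  then obtain a0 where a0: "a0 \<in> ?A" by blast
  have a0B: "a0 \<notin> ?B" using a0 by (auto simp: A B)
  \<comment> \<open>The vertices of \<open>B\<close> keep distinct colours, and all of \<open>A\<close> gets the colour \<open>a0\<close>.\<close>
  have "p \<le> card ((\<lambda>x. if x \<in> ?A then a0 else x) ` (?A \<union> ?B))"
    using A_indep a0B adjacent_irrefl[OF G] by (intro many) auto
  also have "\<dots> \<le> card (insert a0 ?B)" using fin by (intro card_mono) auto
  finally have B_card: "card ?B = p - 1" using B_le a0B fin by simp
  then show "card ?B = chromatic_number G - 1" by (simp add: p_def)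
  show B_clique: "(u, v) \<in> parcs G" if "u \<in> ?B" "v \<in> ?B" "u \<noteq> v" for u v
  proof (rule ccontr)
    assume non: "(u, v) \<notin> parcs G"
    then have non': "(v, u) \<notin> parcs G" using adjacent_sym[OF G] by blast
    \<comment> \<open>Two nonadjacent vertices of \<open>B\<close> could share a colour.\<close>
    let ?h = "\<lambda>x. if x \<in> ?A then a0 else if x = v then u else x"
    have "p \<le> card (?h ` (?A \<union> ?B))"
      using A_indep a0B adjacent_irrefl[OF G] that non non'
      by (intro many) (auto split: if_splits)
    also have "\<dots> \<le> card (insert a0 (?B - {v}))" using fin that by (intro card_mono) auto
    also have "\<dots> = card ?B" using fin that a0B card_Suc_Diff1[of ?B v] by simp
    finally show False using B_card pos by simp
  qed
  have AC_card: "card (?A \<union> ?C) = q" using cards B_card pq pos by simp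
  show AC_indep: "(u, v) \<notin> parcs G" if uv: "u \<in> ?A \<union> ?C" "v \<in> ?A \<union> ?C" for u v
  proof
    assume adj: "(u, v) \<in> parcs G"
    then have adj': "(v, u) \<in> parcs G" "u \<noteq> v"
      using adjacent_sym[OF G] adjacent_irrefl[OF G] by auto
    \<comment> \<open>Two vertices that are adjacent in \<open>G\<close> could share a colour in the complement.\<close>
    have "q \<le> card ((\<lambda>x. if x = v then u else x) ` (?A \<union> ?C))"
      using adj adj' by (intro many') auto
    also have "\<dots> \<le> card ((?A \<union> ?C) - {v})" using fin uv adj' by (intro card_mono) auto
    also have "\<dots> < card (?A \<union> ?C)" using fin uv by (intro psubset_card_mono) auto
    finally show False using AC_card by simp
  qed
  show "neighbors G a = ?B" if "a \<in> ?A" for a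
  proof (rule card_subset_eq)
    show "finite ?B" by (rule fin)
    show "neighbors G a \<subseteq> ?B"
    proof
      fix u assume "u \<in> neighbors G a"
      then have "u \<in> pverts G" "u \<notin> ?A \<union> ?C"
        using AC_indep[of a u] that adjacent_in_pverts[OF G] by auto
      then show "u \<in> ?B" by (auto simp: A B C)
    qed
    show "card (neighbors G a) = card ?B" using that B_card by (simp add: A)
  qed
qed

section \<open>Distinguishing colourings of split graphs\<close>

text \<open>
  The invariance of the clique excludes graphs such as two isolated vertices with \<open>K\<close> and \<open>I\<close>
  singletons, where an automorphism exchanges a vertex of \<open>K\<close> with one of \<open>I\<close>; the formula below
  fails for them.
\<close>

locale rigid_split_graph =
  fixes H :: "'a pair_pre_digraph" and K I :: "'a set"
  assumes graph: "pair_graph H"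
    and pverts_eq: "pverts H = K \<union> I"
    and disjoint: "K \<inter> I = {}"
    and clique: "\<And>u v. u \<in> K \<Longrightarrow> v \<in> K \<Longrightarrow> u \<noteq> v \<Longrightarrow> (u, v) \<in> parcs H"
    and independent: "\<And>u v. u \<in> I \<Longrightarrow> v \<in> I \<Longrightarrow> (u, v) \<notin> parcs H"
    and clique_invariant: "\<And>f v. automorphism H f \<Longrightarrow> v \<in> K \<Longrightarrow> f v \<in> K"
begin

definition twins :: "'a \<Rightarrow> 'a set" where
  "twins v = {u \<in> I. neighbors H u = neighbors H v}"

lemma finite_parts: "finite K" "finite I"
  using finite_pverts[OF graph] by (simp_all add: pverts_eq)

lemma neighbors_subset_clique:
  assumes "v \<in> I"
  shows "neighbors H v \<subseteq> K"
proof
  fix u assume "u \<in> neighbors H v"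
  then show "u \<in> K"
    using independent[OF assms, of u] adjacent_in_pverts(2)[OF graph, of v u] by (auto simp: pverts_eq)
qed

lemma inj_on_twins:
  assumes "distinguishing_coloring H c"
  shows "inj_on c (twins v)"
proof (rule inj_onI, rule ccontr)
  fix x y assume "x \<in> twins v" "y \<in> twins v" "c x = c y" "x \<noteq> y"
  then show False
    using twins_get_distinct_colors[OF graph assms, of x y] by (auto simp: twins_def pverts_eq)
qed

lemma card_twins_le_distinguishing_number: "card (twins v) \<le> distinguishing_number H"
proof -
  obtain c where "distinguishing_coloring H c" "num_colors H c = distinguishing_number H"
    using distinguishing_number_attained[OF graph] .
  then show ?thesis
    using card_le_num_colors[OF finite_pverts[OF graph] inj_on_twins, of c v]
    by (auto simp: pverts_eq twins_def)
qed

text \<open>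
  A proper distinguishing colouring is injective on the clique, and on the twins of \<open>v\<close> together
  with their common neighbours, which gives the lower bounds. Conversely, colour the clique
  injectively and each class of twins injectively by colours that do not occur among its neighbours.
  An automorphism that preserves these colours fixes the invariant clique pointwise; hence it maps
  each independent vertex to a twin of it, which has the same colour only if it is the same vertex.
\<close>

lemma distinguishing_chromatic_number_le_iff:
  "distinguishing_chromatic_number H \<le> k \<longleftrightarrow>
    card K \<le> k \<and> (\<forall>v \<in> I. card (twins v) + card (neighbors H v) \<le> k)"
proof (intro iffI conjI ballI)
  assume le: "distinguishing_chromatic_number H \<le> k"
  obtain c where proper: "proper_coloring H c" and dist: "distinguishing_coloring H c"
    and num: "num_colors H c = distinguishing_chromatic_number H"
    using distinguishing_chromatic_number_attained[OF graph] .
  have adj: "c u \<noteq> c v" if "(u, v) \<in> parcs H" for u v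
    using proper that by (auto simp: proper_coloring_def)
  have inj_K: "inj_on c K" using adj clique by (meson inj_onI)
  then show "card K \<le> k"
    using card_le_num_colors[OF finite_pverts[OF graph], of c K] le num by (auto simp: pverts_eq)
  fix v assume v: "v \<in> I"
  have sub: "neighbors H v \<subseteq> K" "twins v \<subseteq> I"
    using neighbors_subset_clique[OF v] by (auto simp: twins_def)
  have "inj_on c (twins v \<union> neighbors H v)"
  proof (subst inj_on_Un, intro conjI)
    show "inj_on c (twins v)" by (rule inj_on_twins[OF dist])
    show "inj_on c (neighbors H v)" using inj_K sub inj_on_subset by blast
    have "(x, y) \<in> parcs H" if "x \<in> twins v" "y \<in> neighbors H v" for x y
      using that by (auto simp: twins_def)
    then show "c ` (twins v - neighbors H v) \<inter> c ` (neighbors H v - twins v) = {}"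
      using adj by fastforce
  qed
  then have "card (twins v \<union> neighbors H v) \<le> num_colors H c"
    using sub by (intro card_le_num_colors[OF finite_pverts[OF graph]]) (auto simp: pverts_eq)
  moreover have "card (twins v \<union> neighbors H v) = card (twins v) + card (neighbors H v)"
    using sub disjoint finite_parts by (intro card_Un_disjoint) (auto intro: finite_subset)
  ultimately show "card (twins v) + card (neighbors H v) \<le> k" using le num by simp
next
  assume bound: "card K \<le> k \<and> (\<forall>v \<in> I. card (twins v) + card (neighbors H v) \<le> k)"
  obtain e where e: "inj_on e K" "e ` K \<subseteq> {..<k}"
    using card_le_inj[of K "{..<k}"] bound finite_parts by auto
  have "\<exists>g. inj_on g (twins v) \<and> g ` twins v \<subseteq> {..<k} - e ` neighbors H v" if v: "v \<in> I" for v
  proof -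
    have sub: "neighbors H v \<subseteq> K" by (rule neighbors_subset_clique[OF v])
    then have "card (e ` neighbors H v) = card (neighbors H v)"
      using e(1) by (meson card_image inj_on_subset)
    moreover have "e ` neighbors H v \<subseteq> {..<k}" using e(2) sub by blast
    ultimately have "card ({..<k} - e ` neighbors H v) = k - card (neighbors H v)"
      using finite_neighbors[OF graph] by (simp add: card_Diff_subset)
    then have "card (twins v) \<le> card ({..<k} - e ` neighbors H v)" using bound v by fastforce
    moreover have "finite (twins v)" using finite_parts by (simp add: twins_def)
    ultimately show ?thesis
      using card_le_inj[of "twins v" "{..<k} - e ` neighbors H v"] by auto
  qed
  then have "\<forall>N \<in> neighbors H ` I. \<exists>g. inj_on g {u \<in> I. neighbors H u = N} \<and>
      g ` {u \<in> I. neighbors H u = N} \<subseteq> {..<k} - e ` N"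
    by (simp add: twins_def)
  from bchoice[OF this] obtain g where "\<forall>N \<in> neighbors H ` I.
      inj_on (g N) {u \<in> I. neighbors H u = N} \<and>
      g N ` {u \<in> I. neighbors H u = N} \<subseteq> {..<k} - e ` N" ..
  then have g: "inj_on (g (neighbors H v)) (twins v)"
    "g (neighbors H v) ` twins v \<subseteq> {..<k} - e ` neighbors H v" if "v \<in> I" for v
    using that by (simp_all add: twins_def)
  define c where "c x = (if x \<in> K then e x else g (neighbors H x) x)" for x
  have c_K: "c x = e x" if "x \<in> K" for x using that by (simp add: c_def)
  have c_I: "c x = g (neighbors H x) x" if "x \<in> I" for x using that disjoint by (auto simp: c_def)
  have self: "x \<in> twins x" if "x \<in> I" for x using that by (simp add: twins_def)
  have c_I_range: "c x \<in> {..<k} - e ` neighbors H x" if "x \<in> I" for x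
    using g(2)[OF that] self[OF that] c_I[OF that] by auto
  have cross: "c u \<noteq> c v" if "u \<in> I" "(u, v) \<in> parcs H" for u v
    using c_I_range[OF that(1)] that neighbors_subset_clique[OF that(1)] c_K[of v]
    by (auto simp: subset_iff)
  have proper: "proper_coloring H c"
    unfolding proper_coloring_def
  proof clarify
    fix u v assume uv: "(u, v) \<in> parcs H" "c u = c v"
    have vu: "(v, u) \<in> parcs H" using adjacent_sym[OF graph uv(1)] .
    then have "u \<in> K" "v \<in> K"
      using uv cross[of u v] cross[of v u] adjacent_in_pverts[OF graph uv(1)] pverts_eq by auto
    then have "u = v" using uv(2) e(1) by (simp add: c_K inj_on_def)
    then show False using uv(1) adjacent_irrefl[OF graph] by simp
  qed
  have dist: "distinguishing_coloring H c"
    unfolding distinguishing_coloring_def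
  proof (intro allI impI)
    fix f assume f: "automorphism H f" and same: "\<forall>v \<in> pverts H. c (f v) = c v"
    have bij: "bij_betw f (pverts H) (pverts H)" using f by (simp add: automorphism_def)
    have fix_K: "f v = v" if "v \<in> K" for v
    proof (rule inj_onD[OF e(1)])
      have "c (f v) = c v" using same that by (simp add: pverts_eq)
      then show "e (f v) = e v" using c_K clique_invariant[OF f that] that by simp
    qed (use clique_invariant[OF f that] that in auto)
    have fix_I: "f v = v" if v: "v \<in> I" for v
    proof -
      have V: "v \<in> pverts H" "f v \<in> pverts H" using v bij by (auto simp: pverts_eq bij_betw_def)
      have "f v \<notin> K"
      proof
        assume "f v \<in> K"
        then have "f (f v) = f v" by (rule fix_K)
        then have "f v = v" using bij V by (auto simp: bij_betw_def inj_on_def)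
        then show False using \<open>f v \<in> K\<close> v disjoint by auto
      qed
      then have fv: "f v \<in> I" using V by (simp add: pverts_eq)
      have "(f v, w) \<in> parcs H \<longleftrightarrow> (v, w) \<in> parcs H" if "w \<in> K" for w
        using f V fix_K[OF that] that unfolding automorphism_def
        by (metis UnI1 pverts_eq)
      then have "neighbors H (f v) = neighbors H v"
        using neighbors_subset_clique[OF v] neighbors_subset_clique[OF fv] by auto
      moreover from this have "f v \<in> twins v" using fv by (simp add: twins_def)
      moreover have "c (f v) = c v" using same V by simp
      ultimately show ?thesis
        using g(1)[OF v] self[OF v] c_I[OF v] c_I[OF fv] by (simp add: inj_on_def)
    qed
    show "\<forall>v \<in> pverts H. f v = v" using fix_K fix_I by (auto simp: pverts_eq)
  qed
  have "c ` pverts H \<subseteq> {..<k}" using e(2) c_K c_I_range by (auto simp: pverts_eq)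
  then have "num_colors H c \<le> k"
    unfolding num_colors_def by (metis card_lessThan card_mono finite_lessThan)
  then show "distinguishing_chromatic_number H \<le> k"
    using distinguishing_chromatic_number_le[OF proper dist] by simp
qed

end

section \<open>NGD-graphs among the Type 2 NG-graphs\<close>

theorem corollary4p13:
  fixes G :: "'a pair_pre_digraph"
  assumes "pair_graph G"
    and "NG_graph G"
    and "type2 G"
  shows "NGD_graph G \<longleftrightarrow>
    distinguishing_number G = card (A_part G) \<or>
    distinguishing_number G = card {b \<in> B_part G. \<forall>c \<in> C_part G. (b, c) \<notin> parcs G}"
proof -
  note G = assms(1)
  note G' = pair_graph_complement[OF G]
  note struct = type2_NG_structure[OF assms]
  define A B C where "A = A_part G" and "B = B_part G" and "C = C_part G"
  define B0 where "B0 = {b \<in> B. \<forall>c \<in> C. (b, c) \<notin> parcs G}"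
  define D where "D = distinguishing_number G"
  define P where "P = distinguishing_chromatic_number G"
  define Q where "Q = distinguishing_chromatic_number (complement G)"
  note abc = A_def B_def C_def
  note parts = A_part_def B_part_def C_part_def out_degree_eq_card_neighbors
  have V: "pverts G = A \<union> B \<union> C" by (auto simp: abc parts)
  have disj: "A \<inter> B = {}" "A \<inter> C = {}" "B \<inter> C = {}" by (auto simp: abc parts)
  have fin: "finite A" "finite B" "finite C" using finite_pverts[OF G] by (auto simp: V)
  have n: "card (pverts G) = card A + card B + card C"
    using fin disj by (simp add: V card_Un_disjoint Int_Un_distrib2)
  have A_pos: "card A \<ge> 1" using struct(1) fin by (simp add: abc Suc_le_eq card_gt_0_iff)
  have N_A: "neighbors G x = B" if "x \<in> A" for x using struct(4) that by (simp add: abc)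
  have N_C: "neighbors G y \<subseteq> B" "card (neighbors G y) < card B" if "y \<in> C" for y
    using that struct(3)[of y] struct(5) adjacent_in_pverts[OF G, of y]
    by (auto simp: V) (auto simp: abc parts)
  have N_B: "neighbors (complement G) x = C - neighbors G x" if "x \<in> B" for x
  proof -
    have "(x, u) \<in> parcs G" if "u \<in> A" for u
      using N_A[OF that] \<open>x \<in> B\<close> adjacent_sym[OF G, of u x] by auto
    then show ?thesis using that struct(2)[of x] disj by (auto simp: V abc)
  qed
  have inv: "f v \<in> B \<longleftrightarrow> v \<in> B" "f v \<in> pverts G"
    if "automorphism G f" "v \<in> pverts G" for f v
  proof -
    show "f v \<in> pverts G" using that by (auto simp: automorphism_def bij_betw_def)
    then show "f v \<in> B \<longleftrightarrow> v \<in> B"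
      using that automorphism_preserves_degree[OF G that] by (simp add: abc parts)
  qed
  interpret S: rigid_split_graph G B "A \<union> C"
  proof (rule rigid_split_graph.intro)
    show "f v \<in> B" if "automorphism G f" "v \<in> B" for f v
      using inv(1)[of f v] that by (simp add: V)
  qed (use G disj struct(2,3) in \<open>auto simp: V abc\<close>)
  interpret T: rigid_split_graph "complement G" "A \<union> C" B
  proof (rule rigid_split_graph.intro)
    show "f v \<in> A \<union> C" if "automorphism (complement G) f" "v \<in> A \<union> C" for f v
      using inv[of f v] that disj by (auto simp: automorphism_complement_iff[OF G] V)
  qed (use G' disj struct(2,3) in \<open>auto simp: V abc\<close>)
  have S_twins_A: "S.twins x = A" if "x \<in> A" for x
    using N_A N_C(2) that by (force simp: S.twins_def)
  have S_twins_C: "S.twins y \<subseteq> C" if "y \<in> C" for y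
    using N_A N_C(2)[OF that] by (auto simp: S.twins_def)
  have T_twins_B0: "T.twins x = B0" "neighbors (complement G) x = C" if "x \<in> B0" for x
    using that N_B by (auto simp: T.twins_def B0_def)
  have P_iff: "P \<le> k \<longleftrightarrow> card A + card B \<le> k \<and>
      (\<forall>y \<in> C. card (S.twins y) + card (neighbors G y) \<le> k)" for k
    using struct(1) unfolding P_def S.distinguishing_chromatic_number_le_iff
    by (auto simp: S_twins_A N_A ball_Un simp flip: abc)
  have Q_iff: "Q \<le> k \<longleftrightarrow> card A + card C \<le> k \<and>
      (\<forall>x \<in> B. card (T.twins x) + card (neighbors (complement G) x) \<le> k)" for k
    using fin disj unfolding Q_def T.distinguishing_chromatic_number_le_iff
    by (simp add: card_Un_disjoint)
  have D_ge: "card A \<le> D" "\<And>y. card (S.twins y) \<le> D" "\<And>x. card (T.twins x) \<le> D"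
    using struct(1) S_twins_A S.card_twins_le_distinguishing_number
      T.card_twins_le_distinguishing_number distinguishing_number_complement[OF G]
    by (auto simp: D_def simp flip: abc) (metis all_not_in_conv)
  have N_B_le: "card (neighbors (complement G) x) \<le> card C" if "x \<in> B" for x
    using fin N_B[OF that] by (simp add: card_mono)
  \<comment> \<open>The twins of \<open>y\<close> are neighbours of \<open>x\<close> as well.\<close>
  have adjacent_bound: "card (S.twins y) + card (neighbors (complement G) x) \<le> card C"
    if "x \<in> B" "y \<in> C" "(x, y) \<in> parcs G" for x y
  proof -
    have "(x, u) \<in> parcs G" if "u \<in> S.twins y" for u
      using that \<open>(x, y) \<in> parcs G\<close> adjacent_sym[OF G] by (auto simp: S.twins_def set_eq_iff)
    then have "S.twins y \<inter> neighbors (complement G) x = {}" by auto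
    moreover have "S.twins y \<union> neighbors (complement G) x \<subseteq> C"
      using S_twins_C[OF that(2)] N_B[OF that(1)] by auto
    ultimately show ?thesis
      using fin by (metis card_Un_disjoint card_mono finite_subset le_sup_iff)
  qed
  \<comment> \<open>The twins of \<open>x\<close> are not adjacent to \<open>y\<close> either.\<close>
  have nonadjacent_bound: "card (T.twins x) + card (neighbors G y) \<le> card B"
    if "x \<in> B" "y \<in> C" "(x, y) \<notin> parcs G" for x y
  proof -
    have "(u, y) \<notin> parcs G" if u: "u \<in> T.twins x" for u
    proof -
      have "y \<in> neighbors (complement G) x"
        using N_B[OF \<open>x \<in> B\<close>] \<open>y \<in> C\<close> \<open>(x, y) \<notin> parcs G\<close> by simp
      then have "y \<in> neighbors (complement G) u" using u by (simp add: T.twins_def)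
      then show ?thesis by simp
    qed
    then have "T.twins x \<inter> neighbors G y = {}"
      using adjacent_sym[OF G] by (metis disjoint_iff in_neighbors_iff)
    moreover have "T.twins x \<union> neighbors G y \<subseteq> B"
      using N_C(1)[OF that(2)] by (auto simp: T.twins_def)
    ultimately show ?thesis
      using fin by (metis card_Un_disjoint card_mono finite_subset le_sup_iff)
  qed
  have "P + Q = card A + card B + card C + D \<longleftrightarrow> D = card A \<or> D = card B0"
  proof
    assume "D = card A \<or> D = card B0"
    then show "P + Q = card A + card B + card C + D"
    proof
      assume D: "D = card A"
      have "card (S.twins y) + card (neighbors G y) \<le> card A + card B" if "y \<in> C" for y
        using D_ge(2)[of y] N_C(2)[OF that] D by simp
      then have "P = card A + card B" using P_iff by (meson antisym order_refl)
      moreover have "card (T.twins x) + card (neighbors (complement G) x) \<le> card A + card C"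
        if "x \<in> B" for x
        using D_ge(3)[of x] N_B_le[OF that] D by simp
      then have "Q = card A + card C" using Q_iff by (meson antisym order_refl)
      ultimately show ?thesis using D by simp
    next
      assume D: "D = card B0"
      have B0_sub: "B0 \<subseteq> B" by (auto simp: B0_def)
      have "card (S.twins y) + card (neighbors G y) \<le> card A + card B" if "y \<in> C" for y
      proof -
        have "neighbors G y \<subseteq> B - B0"
          using N_C(1)[OF that] that adjacent_sym[OF G] by (auto simp: B0_def)
        then have "card (neighbors G y) \<le> card (B - B0)" using fin by (intro card_mono) auto
        also have "\<dots> = card B - card B0" using B0_sub fin by (metis card_Diff_subset finite_subset)
        finally show ?thesis using D_ge(2)[of y] D card_mono[OF fin(2) B0_sub] by simp
      qed
      then have "P = card A + card B" using P_iff by (meson antisym order_refl)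
      moreover have "Q = D + card C"
      proof (rule antisym)
        show "Q \<le> D + card C"
          unfolding Q_iff using D_ge(1,3) N_B_le by (auto intro: add_mono)
        have "B0 \<noteq> {}" using D D_ge(1) A_pos by auto
        then obtain x where "x \<in> B0" by blast
        then show "D + card C \<le> Q"
          using Q_iff[of Q] T_twins_B0[of x] D B0_sub by auto
      qed
      ultimately show ?thesis by simp
    qed
  next
    assume sum: "P + Q = card A + card B + card C + D"
    \<comment> \<open>\<open>P - 1\<close>, which does not truncate as \<open>A\<close> is nonempty, violates one of the bounds on \<open>P\<close>.\<close>
    have P_cases: "P = card A + card B \<or> (\<exists>y \<in> C. P = card (S.twins y) + card (neighbors G y))"
      using P_iff[of P] P_iff[of "P - 1"] A_pos by fastforce
    have Q_cases: "Q = card A + card C \<or>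
        (\<exists>x \<in> B. Q = card (T.twins x) + card (neighbors (complement G) x))"
      using Q_iff[of Q] Q_iff[of "Q - 1"] A_pos by fastforce
    have P: "P = card A + card B"
    proof (rule ccontr)
      assume "P \<noteq> card A + card B"
      then obtain y where y: "y \<in> C" "P = card (S.twins y) + card (neighbors G y)"
        using P_cases by blast
      have "Q \<noteq> card A + card C" using sum y D_ge(2)[of y] N_C(2)[of y] by auto
      then obtain x where x: "x \<in> B" "Q = card (T.twins x) + card (neighbors (complement G) x)"
        using Q_cases by blast
      show False
      proof (cases "(x, y) \<in> parcs G")
        case True
        then show False
          using adjacent_bound[OF x(1) y(1)] sum x y D_ge(3)[of x] N_C(2)[of y] A_pos by auto
      next
        case False
        then show False
          using nonadjacent_bound[OF x(1) y(1)] sum x y D_ge(2)[of y] N_B_le[of x] A_pos by auto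
      qed
    qed
    show "D = card A \<or> D = card B0"
    proof (cases "Q = card A + card C")
      case True
      then show ?thesis using P sum by simp
    next
      case False
      then obtain x where x: "x \<in> B" "Q = card (T.twins x) + card (neighbors (complement G) x)"
        using Q_cases by blast
      have eq: "card (neighbors (complement G) x) = card C" "D = card (T.twins x)"
        using P sum x D_ge(3)[of x] N_B_le[of x] by auto
      have "C - neighbors G x = C"
        using eq(1) fin N_B[OF x(1)] by (metis Diff_subset card_subset_eq)
      then have "x \<in> B0" using x(1) by (auto simp: B0_def)
      then show ?thesis using eq(2) T_twins_B0 by simp
    qed
  qed
  then show ?thesis
    unfolding NGD_graph_def n by (simp only: P_def Q_def D_def B0_def A_def B_def C_def)
qed

end
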